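(* Let $w\ge 1$ be an integer. For every nonzero configuration $x\in\{0,1\}^{\mathbb Z}$ with $\operatorname{supp}(x)\subseteq[-w,w]$, the longest constant prefix of the central trace of $x$ has length at most $w+2$. Moreover, the number of nonzero configurations $x$ with $\operatorname{supp}(x)\subseteq[-w,w]$ whose longest constant prefix has length exactly $w+2$ is $2^w$ if $w$ is even, and $2^w-1$ if $w$ is odd.
   Context: Rule 30 is the map $F:\{0,1\}^{\mathbb Z}\to\{0,1\}^{\mathbb Z}$ given by $F(x)_i=x_{i-1}\oplus(x_i\lor x_{i+1})$, where $\oplus$ is addition modulo $2$ and $\lor$ is Boolean disjunction. $F^t$ is the $t$-fold iterate, with $F^0(x)=x$. The support is $\operatorname{supp}(x)=\{i\in\mathbb Z:x_i=1\}$. The central trace of $x$ is the sequence $(c_t)_{t\ge0}$ with $c_t=F^t(x)_0$. The length of its longest constant prefix is the largest $n\ge 1$ such that $c_0=c_1=\dots=c_{n-1}$ (the length counts symbols, including the one at time $0$). *)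

theory Defs
  imports Main "HOL-Library.Extended_Nat"
begin

text \<open>Configurations in \<open>{0,1}\<^sup>\<int>\<close> are functions \<open>int \<Rightarrow> bool\<close>, with \<open>True\<close> for 1 and \<open>False\<close> for 0;
  on \<open>bool\<close>, addition modulo 2 is \<open>\<noteq>\<close>.\<close>

type_synonym config = "int \<Rightarrow> bool"

definition rule30 :: "config \<Rightarrow> config" where
  "rule30 x = (\<lambda>i. x (i - 1) \<noteq> (x i \<or> x (i + 1)))"

definition supp :: "config \<Rightarrow> int set" where
  "supp x = {i. x i}"

definition central_trace :: "config \<Rightarrow> nat \<Rightarrow> bool" where
  "central_trace x t = (rule30 ^^ t) x 0"

text \<open>The value is taken in \<open>enat\<close> because the set of lengths of constant prefixes is
  unbounded for a constant sequence, whose value is then \<open>\<infinity>\<close>; otherwise the supremum is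
  the maximum. The length counts symbols, including the one at time 0.\<close>

definition longest_constant_prefix :: "(nat \<Rightarrow> bool) \<Rightarrow> enat" where
  "longest_constant_prefix c = Sup {enat n | n. n \<ge> 1 \<and> (\<forall>s<n. c s = c 0)}"

end

theory Submission
  imports Defs
begin

text \<open>
  Rule 30 can be solved for its leftmost argument: \<open>x\<^bsub>i-1\<^esub> = F(x)\<^sub>i \<oplus> (x\<^sub>i \<or> x\<^bsub>i+1\<^esub>)\<close>. Hence the
  cells to the right of the origin and the first \<open>n\<close> symbols of the central trace together
  determine the cells \<open>0, -1, ..., -(n-1)\<close>, and conversely the trace up to time \<open>n - 1\<close> depends
  on no cell further to the left (\<open>trace_eq_iff_agree\<close>).

  For a constant trace the determined left half has a closed form, \<open>const_ext c x\<close>. A trace of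
  ones forces the alternating left half that is 1 at the even cells. A trace of zeros forces the
  left half 0 if the right half is 0; otherwise, with \<open>p\<close> the position of the first 1 on the
  right, it is 1 exactly at \<open>-p\<close> and at all odd cells \<open>-j\<close> with \<open>j \<ge> p\<close>. Both families are
  invariant under the rule, so these configurations have a constant trace for all time, and a
  configuration has a constant prefix of length \<open>n\<close> iff it agrees with its \<open>const_ext\<close> to the
  right of \<open>-n\<close> (\<open>constant_prefix_iff\<close>).

  Let the support now lie in \<open>[-w, w]\<close>. For \<open>m > w\<close> the closed form alternates: unless it
  vanishes identically, its value at \<open>-m\<close> is 1 exactly for even \<open>m\<close> if \<open>c\<close> is 1, and exactly for odd
  \<open>m\<close> if \<open>c\<close> is 0 (\<open>const_ext_beyond\<close>). A prefix of length \<open>w + 3\<close> would require 0 at two consecutive such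
  cells, which is impossible. A prefix of length \<open>w + 2\<close> requires 0 at \<open>-(w+1)\<close> only, which
  says that \<open>c\<close> is 1 iff \<open>w\<close> is even. The right half is then free, except that it must not
  vanish when \<open>c\<close> is 0, and it determines the configuration: this gives \<open>2^w\<close> or \<open>2^w - 1\<close>
  possibilities.
\<close>

section \<open>Left permutivity\<close>

lemma rule30_apply: "rule30 x i \<longleftrightarrow> x (i - 1) \<noteq> (x i \<or> x (i + 1))"
  by (simp add: rule30_def)

lemma central_trace_0: "central_trace x 0 = x 0"
  by (simp add: central_trace_def)

lemma central_trace_Suc: "central_trace x (Suc t) = central_trace (rule30 x) t"
  by (simp add: central_trace_def funpow_Suc_right del: funpow.simps)

text \<open>One step costs one cell on the left of the known region, and conversely one more symbol
  of the trace recovers one more cell there by solving the rule for its leftmost argument.\<close>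

lemma trace_eq_iff_agree:
  assumes "\<forall>i>0. x i = y i"
  shows "(\<forall>t<n. central_trace x t = central_trace y t) \<longleftrightarrow> (\<forall>i>- int n. x i = y i)"
  using assms
proof (induction n arbitrary: x y)
  case 0
  then show ?case by simp
next
  case (Suc n)
  have split: "(\<forall>t<Suc n. central_trace x t = central_trace y t) \<longleftrightarrow>
      x 0 = y 0 \<and> (\<forall>t<n. central_trace (rule30 x) t = central_trace (rule30 y) t)"
    unfolding All_less_Suc2 central_trace_Suc central_trace_0 by blast
  show ?case
  proof (cases "x 0 = y 0")
    case False
    then show ?thesis using split by fastforce
  next
    case True
    with Suc.prems have right: "x i = y i" if "i \<ge> 0" for i
      using that by (cases "i = 0") auto
    have "\<forall>i>0. rule30 x i = rule30 y i"
      using right by (simp add: rule30_apply)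
    from Suc.IH[OF this]
    have IH: "(\<forall>t<n. central_trace (rule30 x) t = central_trace (rule30 y) t) \<longleftrightarrow>
        (\<forall>i>- int n. rule30 x i = rule30 y i)" .
    have "(\<forall>i>- int n. rule30 x i = rule30 y i) \<longleftrightarrow> (\<forall>i>- int (Suc n). x i = y i)"
    proof
      assume images: "\<forall>i>- int n. rule30 x i = rule30 y i"
      have "\<forall>i\<ge>- int j. x i = y i" if "j \<le> n" for j
        using that
      proof (induction j)
        case 0
        then show ?case using right by simp
      next
        case (Suc j)
        then have known: "x i = y i" if "i \<ge> - int j" for i
          using that by simp
        have "rule30 x (- int j) = rule30 y (- int j)"
          using images Suc.prems by simp
        then have "x (- int j - 1) = y (- int j - 1)"
          using known[of "- int j"] known[of "- int j + 1"] by (auto simp: rule30_apply)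
        moreover have "i = - int j - 1 \<or> i \<ge> - int j" if "i \<ge> - int (Suc j)" for i
          using that by auto
        ultimately show ?case using known by blast
      qed
      from this[of n] show "\<forall>i>- int (Suc n). x i = y i" by simp
    next
      assume "\<forall>i>- int (Suc n). x i = y i"
      then show "\<forall>i>- int n. rule30 x i = rule30 y i" by (simp add: rule30_apply)
    qed
    with split IH True show ?thesis by blast
  qed
qed

section \<open>Configurations with a constant central trace\<close>

definition first_one :: "config \<Rightarrow> int \<Rightarrow> bool" where
  "first_one x p \<longleftrightarrow> 0 < p \<and> x p \<and> (\<forall>k. 0 < k \<and> k < p \<longrightarrow> \<not> x k)"

text \<open>The extension of the right half of \<open>x\<close> whose central trace is constantly \<open>c\<close>. The cells
  of \<open>x\<close> at positions \<open>\<le> 0\<close> are discarded, so that \<open>x\<close> itself can be compared with it.\<close>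

definition const_ext :: "bool \<Rightarrow> config \<Rightarrow> config" where
  "const_ext c x = (\<lambda>i. if 0 < i then x i
     else if c then even i
     else \<exists>p. first_one x p \<and> (p = - i \<or> odd i \<and> p \<le> - i))"

lemma const_ext_pos: "0 < i \<Longrightarrow> const_ext c x i = x i"
  by (simp add: const_ext_def)

lemma const_ext_0: "const_ext c x 0 = c"
  by (auto simp: const_ext_def first_one_def)

lemma first_one_exists:
  assumes "0 < k" "x k"
  obtains p where "first_one x p" "p \<le> k"
proof -
  define n where "n = (LEAST n. 0 < n \<and> x (int n))"
  have ex: "0 < nat k \<and> x (int (nat k))" using assms by simp
  then have n: "0 < n \<and> x (int n)" unfolding n_def by (rule LeastI)
  have "n \<le> nat k" unfolding n_def using ex by (rule Least_le)
  have "\<not> x j" if "0 < j" "j < int n" for j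
  proof
    assume "x j"
    with that have "n \<le> nat j" unfolding n_def by (intro Least_le) simp
    with that show False by linarith
  qed
  with n have "first_one x (int n)" by (simp add: first_one_def)
  moreover have "int n \<le> k" using \<open>n \<le> nat k\<close> assms by linarith
  ultimately show thesis by (rule that)
qed

lemma first_one_unique: "first_one x p \<Longrightarrow> first_one x q \<Longrightarrow> p = q"
  unfolding first_one_def by (meson linorder_less_linear)

lemma const_ext_False_nonpos:
  assumes "first_one x p" "i \<le> 0"
  shows "const_ext False x i \<longleftrightarrow> p = - i \<or> odd i \<and> p \<le> - i"
proof -
  have "first_one x r \<longleftrightarrow> r = p" for r using assms(1) first_one_unique by blast
  then show ?thesis using assms(2) by (simp add: const_ext_def)
qed

lemma const_ext_False_zero:
  assumes "\<forall>k>0. \<not> x k"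
  shows "const_ext False x = (\<lambda>i. False)"
  using assms by (auto simp: const_ext_def first_one_def fun_eq_iff)

text \<open>Over a boundary of zeros, the first 1 on the right moves left by one cell per step until
  it sits next to the origin, where it stays. The marks that it leaves on the left move with it,
  so the closed form is reproduced with the new position of the first 1.\<close>

lemma rule30_const_ext: "rule30 (const_ext c x) = const_ext c (rule30 (const_ext c x))"
proof (cases c)
  case True
  have "rule30 (const_ext True x) i = even i" if "i \<le> 0" for i
    using that by (cases "i = 0") (auto simp: rule30_apply const_ext_def)
  then show ?thesis using True by (auto simp: const_ext_def fun_eq_iff)
next
  case c: False
  show ?thesis
  proof (cases "\<exists>k>0. x k")
    case False
    then have zero: "const_ext False x = (\<lambda>i. False)"
      by (intro const_ext_False_zero) auto
    have "rule30 (\<lambda>i. False) = (\<lambda>i. False)" by (simp add: rule30_def)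
    then show ?thesis using zero c const_ext_False_zero[of "\<lambda>i. False"] by simp
  next
    case True
    then obtain p where p: "first_one x p" using first_one_exists by metis
    define y where "y = const_ext False x"
    have y: "y i \<longleftrightarrow> p = - i \<or> odd i \<and> p \<le> - i" if "i \<le> 0" for i
      unfolding y_def using const_ext_False_nonpos[OF p that] .
    have before: "\<not> y k" if "0 \<le> k" "k < p" for k
      using p that const_ext_0[of False x]
      by (auto simp: first_one_def y_def const_ext_pos order_le_less)
    have "p > 0" "y p" using p by (auto simp: first_one_def y_def const_ext_pos)
    \<comment> \<open>The position of the first 1 on the right after the step.\<close>
    define q where "q = max 1 (p - 1)"
    have q: "first_one (rule30 y) q"
      unfolding first_one_def
    proof (intro conjI allI impI)
      show "0 < q" by (simp add: q_def)
      show "rule30 y q"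
      proof (cases "p = 1")
        case True
        then show ?thesis using \<open>y p\<close> before[of 0] by (simp add: q_def rule30_apply)
      next
        case False
        then have "q = p - 1" "2 \<le> p" using \<open>p > 0\<close> by (auto simp: q_def)
        then show ?thesis
          using \<open>y p\<close> before[of "p - 2"] by (simp add: rule30_apply)
      qed
      show "\<not> rule30 y k" if "0 < k \<and> k < q" for k
        using that before[of "k - 1"] before[of k] before[of "k + 1"]
        by (auto simp: q_def rule30_apply max_def split: if_splits)
    qed
    have "rule30 y i = const_ext False (rule30 y) i" if "i \<le> 0" for i
    proof (cases "i = 0")
      case True
      have "y (- 1) \<longleftrightarrow> p = 1" using y[of "- 1"] \<open>p > 0\<close> by auto
      moreover have "y 1 \<longleftrightarrow> p = 1"
        using \<open>y p\<close> before[of 1] \<open>p > 0\<close> by (cases "p = 1") auto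
      ultimately show ?thesis
        using True before[of 0] \<open>p > 0\<close> by (simp add: rule30_apply const_ext_0)
    next
      case False
      with that have "i < 0" by simp
      have "rule30 y i \<longleftrightarrow> q = - i \<or> odd i \<and> q \<le> - i"
      proof (cases "even i")
        case True
        then have "i \<le> - 2" using \<open>i < 0\<close> by presburger
        have "y (i - 1) \<longleftrightarrow> p \<le> 1 - i" "y i \<longleftrightarrow> p = - i" "y (i + 1) \<longleftrightarrow> p \<le> - i - 1"
          using y[of "i - 1"] y[of i] y[of "i + 1"] True \<open>i \<le> - 2\<close> by auto
        then have "rule30 y i \<longleftrightarrow> p = 1 - i" by (auto simp: rule30_apply)
        also have "\<dots> \<longleftrightarrow> q = - i" using \<open>i \<le> - 2\<close> by (auto simp: q_def)
        finally show ?thesis using True by simp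
      next
        case False
        have "y (i - 1) \<longleftrightarrow> p = 1 - i" "y i \<longleftrightarrow> p \<le> - i" "y (i + 1) \<longleftrightarrow> p = - i - 1"
          using y[of "i - 1"] y[of i] y[of "i + 1"] False \<open>i < 0\<close> \<open>p > 0\<close> by auto
        then have "rule30 y i \<longleftrightarrow> p \<le> 1 - i" by (auto simp: rule30_apply)
        also have "\<dots> \<longleftrightarrow> q \<le> - i" using \<open>i < 0\<close> by (auto simp: q_def)
        finally show ?thesis using False by auto
      qed
      then show ?thesis using const_ext_False_nonpos[OF q that] by simp
    qed
    then have "rule30 y i = const_ext False (rule30 y) i" for i
      by (cases "i \<le> 0") (simp_all add: const_ext_pos)
    then show ?thesis using c by (simp add: y_def fun_eq_iff)
  qed
qed

lemma central_trace_const_ext: "central_trace (const_ext c x) t = c"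
proof -
  have "\<exists>y. (rule30 ^^ t) (const_ext c x) = const_ext c y"
  proof (induction t)
    case 0
    show ?case by (rule exI[of _ x]) simp
  next
    case (Suc t)
    then obtain y where "(rule30 ^^ t) (const_ext c x) = const_ext c y" by (rule exE)
    then have "(rule30 ^^ Suc t) (const_ext c x) = rule30 (const_ext c y)" by simp
    also have "\<dots> = const_ext c (rule30 (const_ext c y))" by (rule rule30_const_ext)
    finally show ?case by blast
  qed
  then obtain y where "(rule30 ^^ t) (const_ext c x) = const_ext c y" by (rule exE)
  then show ?thesis by (simp add: central_trace_def const_ext_0)
qed

lemma constant_prefix_iff:
  "(\<forall>t<n. central_trace x t = c) \<longleftrightarrow> (\<forall>i>- int n. x i = const_ext c x i)"
proof -
  have "\<forall>i>0. x i = const_ext c x i" using const_ext_pos by blast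
  from trace_eq_iff_agree[OF this, of n] show ?thesis unfolding central_trace_const_ext .
qed

text \<open>The prefix lengths are closed downwards, so the supremum can be compared with a number
  by looking at that single length.\<close>

lemma le_longest_constant_prefix_iff:
  assumes "n \<ge> 1"
  shows "enat n \<le> longest_constant_prefix c \<longleftrightarrow> (\<forall>s<n. c s = c 0)"
proof
  assume "\<forall>s<n. c s = c 0"
  with assms show "enat n \<le> longest_constant_prefix c"
    unfolding longest_constant_prefix_def by (intro Sup_upper) blast
next
  assume "enat n \<le> longest_constant_prefix c"
  moreover have "enat (n - 1) < enat n" using assms by simp
  ultimately have "enat (n - 1) < longest_constant_prefix c"
    using order_less_le_trans by blast
  then obtain m where "enat (n - 1) < enat m" and m: "\<forall>s<m. c s = c 0"
    unfolding longest_constant_prefix_def less_Sup_iff by blast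
  then have "n \<le> m" by simp
  then show "\<forall>s<n. c s = c 0" using m order_less_le_trans by blast
qed

section \<open>Configurations of bounded support\<close>

text \<open>All cells \<open>-m\<close> with \<open>m > w\<close> lie beyond the mirror image of the first 1 on the right, where
  only the alternating part of the closed form is left.\<close>

lemma const_ext_beyond:
  assumes "supp x \<subseteq> {- int w..int w}" "w < m" "c \<or> (\<exists>k>0. x k)"
  shows "const_ext c x (- int m) \<longleftrightarrow> (even m \<longleftrightarrow> c)"
proof (cases c)
  case True
  then show ?thesis using assms(2) by (simp add: const_ext_def)
next
  case False
  with assms(3) obtain p where p: "first_one x p" using first_one_exists by metis
  then have "p \<le> int w" using assms(1) by (auto simp: first_one_def supp_def)
  then show ?thesis using const_ext_False_nonpos[OF p, of "- int m"] False assms(2) by auto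
qed

lemma zero_prefix_zero_right:
  assumes "supp x \<subseteq> {- int w..int w}" "w < n" "\<forall>t<n. central_trace x t = False"
    and "\<forall>k>0. \<not> x k"
  shows "x = (\<lambda>i. False)"
proof
  fix i
  show "x i = False"
  proof (cases "- int n < i")
    case True
    then show ?thesis
      using assms(3) constant_prefix_iff[of n x False] const_ext_False_zero[OF assms(4)] by auto
  next
    case False
    then show ?thesis using assms(1,2) by (auto simp: supp_def)
  qed
qed

lemma constant_prefix_beyond_support:
  assumes supp: "supp x \<subseteq> {- int w..int w}" and nonzero: "x \<noteq> (\<lambda>i. False)"
    and prefix: "\<forall>t<n. central_trace x t = c"
    and m: "w < m" "m < n"
  shows "even m \<longleftrightarrow> \<not> c"
proof -
  have "c \<or> (\<exists>k>0. x k)"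
    using zero_prefix_zero_right[OF supp, of n] nonzero prefix m by (cases c) auto
  then have "const_ext c x (- int m) \<longleftrightarrow> (even m \<longleftrightarrow> c)"
    using const_ext_beyond[OF supp \<open>w < m\<close>] by simp
  moreover have "x (- int m) = const_ext c x (- int m)"
    using prefix m unfolding constant_prefix_iff by simp
  moreover have "\<not> x (- int m)" using supp m by (auto simp: supp_def)
  ultimately show ?thesis by blast
qed

lemma longest_constant_prefix_le:
  assumes "supp x \<subseteq> {- int w..int w}" "x \<noteq> (\<lambda>i. False)"
  shows "longest_constant_prefix (central_trace x) \<le> enat (w + 2)"
proof (rule ccontr)
  assume "\<not> ?thesis"
  then have "enat (w + 3) \<le> longest_constant_prefix (central_trace x)"
    using Suc_ile_eq[of "w + 2"] by (simp add: not_le numeral_eq_Suc)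
  then have "\<forall>t<w + 3. central_trace x t = central_trace x 0"
    by (rule le_longest_constant_prefix_iff[THEN iffD1, rotated]) simp
  from constant_prefix_beyond_support[OF assms this, of "w + 1"]
    constant_prefix_beyond_support[OF assms this, of "w + 2"]
  show False by simp
qed

text \<open>A prefix of length \<open>w + 2\<close> depends on one cell to the left of \<open>[-w, w]\<close>, namely
  \<open>-(w+1)\<close>. Its value 0 forces the constant symbol to be the one belonging to the parity of
  \<open>w\<close>; for that symbol the closed form vanishes there, so that only agreement on \<open>[-w, w]\<close>
  remains. The condition on the right half excludes the zero configuration.\<close>

lemma longest_constant_prefix_eq_iff:
  assumes supp: "supp x \<subseteq> {- int w..int w}"
  shows "x \<noteq> (\<lambda>i. False) \<and> longest_constant_prefix (central_trace x) = enat (w + 2) \<longleftrightarrow>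
    (even w \<or> (\<exists>k>0. x k)) \<and> (\<forall>i\<ge>- int w. x i = const_ext (even w) x i)"
    (is "?L \<longleftrightarrow> ?R")
proof
  assume L: ?L
  then have "enat (w + 2) \<le> longest_constant_prefix (central_trace x)" by simp
  then have "\<forall>t<w + 2. central_trace x t = central_trace x 0"
    by (rule le_longest_constant_prefix_iff[THEN iffD1, rotated]) simp
  then have prefix: "\<forall>t<w + 2. central_trace x t = x 0" by (simp add: central_trace_0)
  have "x 0 = even w"
    using constant_prefix_beyond_support[OF supp _ prefix, of "w + 1"] L by auto
  with prefix have prefix': "\<forall>t<w + 2. central_trace x t = even w" by simp
  then have "\<forall>i\<ge>- int w. x i = const_ext (even w) x i"
    unfolding constant_prefix_iff by auto
  moreover have "even w \<or> (\<exists>k>0. x k)"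
    using zero_prefix_zero_right[OF supp, of "w + 2"] L prefix' by auto
  ultimately show ?R by blast
next
  assume R: ?R
  have agree: "x i = const_ext (even w) x i" if "i > - int (w + 2)" for i
  proof (cases "i = - int (w + 1)")
    case True
    have "\<not> const_ext (even w) x (- int (w + 1))"
      using const_ext_beyond[OF supp, of "w + 1" "even w"] R by auto
    moreover have "\<not> x (- int (w + 1))" using supp by (auto simp: supp_def)
    ultimately show ?thesis using True by simp
  next
    case False
    then have "i \<ge> - int w" using that by simp
    then show ?thesis using R by blast
  qed
  then have prefix: "\<forall>t<w + 2. central_trace x t = even w"
    unfolding constant_prefix_iff by blast
  have "x 0 = even w" using R const_ext_0[of "even w" x] by simp
  then have nonzero: "x \<noteq> (\<lambda>i. False)" using R by auto
  have "enat (w + 2) \<le> longest_constant_prefix (central_trace x)"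
    using prefix by (subst le_longest_constant_prefix_iff) simp_all
  then show ?L using longest_constant_prefix_le[OF supp nonzero] nonzero by simp
qed

lemma const_ext_cong:
  assumes "\<And>k. 0 < k \<Longrightarrow> x k = y k"
  shows "const_ext c x = const_ext c y"
proof -
  have "first_one x = first_one y" using assms by (auto simp: first_one_def fun_eq_iff)
  then show ?thesis using assms by (simp add: const_ext_def fun_eq_iff)
qed

text \<open>Taking right halves is a bijection, with truncation of the closed form to
  \<open>[-w, \<infinity>)\<close> as its inverse.\<close>

lemma card_longest_constant_prefix_eq:
  "card {x. x \<noteq> (\<lambda>i. False) \<and> supp x \<subseteq> {- int w..int w} \<and>
      longest_constant_prefix (central_trace x) = enat (w + 2)}
    = (if even w then 2 ^ w else 2 ^ w - 1)"
    (is "card ?K = _")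
proof -
  let ?ext = "const_ext (even w)"
  define right where "right x = supp x \<inter> {1..int w}" for x
  define fill where "fill R = (\<lambda>i. - int w \<le> i \<and> ?ext (\<lambda>k. k \<in> R) i)" for R
  let ?D = "if even w then Pow {1..int w} else Pow {1..int w} - {{}}"
  have K: "x \<in> ?K \<longleftrightarrow> supp x \<subseteq> {- int w..int w} \<and> (even w \<or> (\<exists>k>0. x k)) \<and>
      (\<forall>i\<ge>- int w. x i = ?ext x i)" for x
    using longest_constant_prefix_eq_iff[of x w] by blast
  have x_right: "x k \<longleftrightarrow> k \<in> right x" if "supp x \<subseteq> {- int w..int w}" "0 < k" for x k
    using that by (auto simp: right_def supp_def)
  have fill_pos: "fill R k \<longleftrightarrow> k \<in> R" if "0 < k" for R k
    using that by (simp add: fill_def const_ext_pos)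
  have "bij_betw right ?K ?D"
  proof (rule bij_betw_byWitness[where f' = fill])
    show "\<forall>x\<in>?K. fill (right x) = x"
    proof (intro ballI ext)
      fix x i
      assume "x \<in> ?K"
      then have x: "supp x \<subseteq> {- int w..int w}" "\<forall>i\<ge>- int w. x i = ?ext x i"
        unfolding K by auto
      have "?ext (\<lambda>k. k \<in> right x) = ?ext x"
        using x_right[OF x(1)] by (intro const_ext_cong) simp
      moreover have "\<not> x i" if "i < - int w" using x(1) that by (auto simp: supp_def)
      ultimately show "fill (right x) i = x i"
        using x(2) by (cases "- int w \<le> i") (simp_all add: fill_def)
    qed
    show "\<forall>R\<in>?D. right (fill R) = R"
    proof
      fix R
      assume "R \<in> ?D"
      then have "R \<subseteq> {1..int w}" by (auto split: if_splits)
      then show "right (fill R) = R" using fill_pos by (fastforce simp: right_def supp_def)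
    qed
    show "right ` ?K \<subseteq> ?D"
    proof
      fix R
      assume "R \<in> right ` ?K"
      then obtain x where x: "x \<in> ?K" and R: "R = right x" by blast
      have "R \<subseteq> {1..int w}" by (simp add: R right_def)
      moreover have "even w \<or> R \<noteq> {}"
        using x x_right[of x] unfolding K R by blast
      ultimately show "R \<in> ?D" by auto
    qed
    show "fill ` ?D \<subseteq> ?K"
    proof
      fix x
      assume "x \<in> fill ` ?D"
      then obtain R where R: "R \<in> ?D" and x: "x = fill R" by blast
      from R have sub: "R \<subseteq> {1..int w}" by (auto split: if_splits)
      have "- int w \<le> i \<and> i \<le> int w" if "x i" for i
        using that sub fill_pos[of i R] by (cases "0 < i") (auto simp: x fill_def)
      then have "supp x \<subseteq> {- int w..int w}" by (auto simp: supp_def)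
      moreover have "even w \<or> (\<exists>k>0. x k)"
      proof (cases "even w")
        case False
        with R obtain k where "k \<in> R" by auto
        with sub have "0 < k" by auto
        with \<open>k \<in> R\<close> fill_pos show ?thesis unfolding x by blast
      qed simp
      moreover have "?ext x = ?ext (\<lambda>k. k \<in> R)"
        using fill_pos by (intro const_ext_cong) (simp add: x)
      then have "\<forall>i\<ge>- int w. x i = ?ext x i" by (simp add: x fill_def)
      ultimately show "x \<in> ?K" unfolding K by blast
    qed
  qed
  then have "card ?K = card ?D" by (rule bij_betw_same_card)
  also have "\<dots> = (if even w then 2 ^ w else 2 ^ w - 1)"
    by (simp add: card_Pow card_Diff_singleton)
  finally show ?thesis .
qed

theorem corollary8:
  fixes w :: nat
  assumes "w \<ge> 1"
  shows "(\<forall>x :: config. x \<noteq> (\<lambda>i. False) \<and> supp x \<subseteq> {- int w..int w} \<longrightarrow>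
            longest_constant_prefix (central_trace x) \<le> enat (w + 2)) \<and>
         card {x :: config. x \<noteq> (\<lambda>i. False) \<and> supp x \<subseteq> {- int w..int w} \<and>
            longest_constant_prefix (central_trace x) = enat (w + 2)}
          = (if even w then 2 ^ w else 2 ^ w - 1)"
  using longest_constant_prefix_le card_longest_constant_prefix_eq by blast

end
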